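(* Let $G$ be a locally compact (Hausdorff) group. If every $\mu\in P(G)$ is a Choquet-Deny measure, then $G$ is point-wise distal.
   Context: $P(G)$ is the space of regular Borel probability measures on $G$. For $\mu\in P(G)$ let $G_\mu$ be the smallest closed subgroup of $G$ containing the support of $\mu$. $\mu$ is a Choquet-Deny measure if every bounded continuous function $f$ on $G$ satisfying $f(g)=\int f(gh)\,d\mu(h)$ for all $g\in G$ is constant on the cosets $gG_\mu$, $g\in G$. $G$ is point-wise distal if for every $g\in G$ the action on $G$ of $\{\gamma^n\}_{n\in\mathbb{N}}$, where $\gamma(x)=gxg^{-1}$, is distal; an action of a semigroup $\Gamma$ on a Hausdorff space $X$ by continuous self-maps is distal if for any two distinct $x,y\in X$ the closure of $\{(\gamma(x),\gamma(y)) : \gamma\in\Gamma\}$ in $X\times X$ does not intersect the diagonal. *)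

theory Defs
  imports "HOL-Probability.Probability"
begin

text \<open>
  Groups are written additively, since the library's class of topological groups is
  \<^class>\<open>topological_group_add\<close>. Commutativity is \<^emph>\<open>not\<close> assumed: \<^class>\<open>group_add\<close> does not
  include it. Thus \<open>g + h\<close>, \<open>- g\<close>, \<open>0\<close> stand for \<open>gh\<close>, \<open>g\<^sup>-\<^sup>1\<close>, \<open>e\<close>,
  and \<open>g + x - g\<close> is the conjugate \<open>gxg\<^sup>-\<^sup>1\<close>. A Hausdorff topological group is a type of sort
  \<open>{topological_group_add, t2_space}\<close>.
\<close>

definition regular_prob_measures :: "'a::t2_space measure set" where
  "regular_prob_measures = {M. prob_space M \<and> sets M = sets borel \<and>
     (\<forall>A \<in> sets M.
        emeasure M A = (SUP K \<in> {K. compact K \<and> K \<subseteq> A}. emeasure M K) \<and>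
        emeasure M A = (INF U \<in> {U. open U \<and> A \<subseteq> U}. emeasure M U))}"

definition measure_support :: "'a::topological_space measure \<Rightarrow> 'a set" where
  "measure_support M = {x. \<forall>U. open U \<and> x \<in> U \<longrightarrow> emeasure M U > 0}"

definition closed_subgroup :: "'a::topological_group_add set \<Rightarrow> bool" where
  "closed_subgroup H \<longleftrightarrow>
     closed H \<and> 0 \<in> H \<and> (\<forall>x\<in>H. \<forall>y\<in>H. x + y \<in> H) \<and> (\<forall>x\<in>H. - x \<in> H)"

definition support_subgroup :: "'a::topological_group_add measure \<Rightarrow> 'a set" where
  "support_subgroup M = \<Inter>{H. closed_subgroup H \<and> measure_support M \<subseteq> H}"

definition choquet_deny :: "'a::topological_group_add measure \<Rightarrow> bool" where
  "choquet_deny M \<longleftrightarrow>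
     (\<forall>f :: 'a \<Rightarrow> complex.
        continuous_on UNIV f \<and> bounded (range f) \<and>
        (\<forall>g. f g = (LINT h|M. f (g + h))) \<longrightarrow>
        (\<forall>g. f constant_on ((+) g ` support_subgroup M)))"

text \<open>
  \<open>\<Gamma>\<close> is the set of maps by which the acting semigroup acts. \<^const>\<open>Id\<close> is the diagonal.
\<close>

definition distal_action :: "('a::t2_space \<Rightarrow> 'a) set \<Rightarrow> bool" where
  "distal_action \<Gamma> \<longleftrightarrow>
     (\<forall>x y. x \<noteq> y \<longrightarrow> closure {(\<gamma> x, \<gamma> y) | \<gamma>. \<gamma> \<in> \<Gamma>} \<inter> Id = {})"

text \<open>
  Including the power \<open>n = 0\<close> makes no difference: it only adds the off-diagonal point
  \<open>(x, y)\<close> to the orbit whose closure is taken.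
\<close>

definition pointwise_distal :: "'a::{topological_group_add, t2_space} itself \<Rightarrow> bool" where
  "pointwise_distal _ \<longleftrightarrow>
     (\<forall>g::'a. distal_action {(\<lambda>x. g + x - g) ^^ n | n :: nat. True})"

end

theory Submission
  imports Defs "HOL-Real_Asymp.Real_Asymp"
begin

text \<open>
  If \<open>G\<close> is not point-wise distal, some conjugation \<open>\<gamma>(x) = g + x - g\<close> has \<open>0\<close> in the closure of the
  points \<open>\<gamma>\<^sup>n(x)\<close> for some \<open>x \<noteq> 0\<close>. A random walk with steps \<open>x + a\<^sub>k g\<close>, \<open>k\<close> random, has position
  \<open>\<gamma>\<^bsup>s(0)\<^esup>(x) + \<gamma>\<^bsup>s(1)\<^esup>(x) + \<dots>\<close> up to a multiple of \<open>g\<close> on the right, where \<open>s(i)\<close> is the sum of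
  the first \<open>i\<close> values \<open>a\<^sub>k\<close>. Let the index \<open>k\<close> be so heavy-tailed that its running maximum is
  eventually attained only once, and choose the \<open>a\<^sub>k\<close> inductively, growing very fast, among the times
  at which \<open>\<gamma>\<^sup>n(x)\<close> returns close to \<open>0\<close>. Started at \<open>a\<^sub>j g\<close> with \<open>j\<close> large, the walk then stays, with
  high probability, close to \<open>0\<close> modulo multiples of \<open>g\<close>, and started at \<open>x + a\<^sub>j g\<close> close to \<open>x\<close>. As
  \<open>x\<close> does not commute with \<open>g\<close>, the function \<open>F(z) = sup \<phi>(z + c)\<close>, \<open>c\<close> in the centralizer of \<open>g\<close> and
  \<open>\<phi>\<close> a bump function at \<open>0\<close>, tells the two apart. A pointwise cluster point of the Cesaro means of
  the expectations of \<open>F\<close> along the walk is a bounded continuous harmonic function that takes different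
  values at \<open>a\<^sub>j g\<close> and \<open>x + a\<^sub>j g\<close>.
\<close>

section \<open>Iterated conjugation and multiples of a group element\<close>

lemma conj_funpow_add:
  fixes g x :: "'a::group_add"
  shows "((\<lambda>x. g + x - g) ^^ n) (x + y) = ((\<lambda>x. g + x - g) ^^ n) x + ((\<lambda>x. g + x - g) ^^ n) y"
  by (induction n) (simp_all add: diff_conv_add_uminus add.assoc del: add_uminus_conv_diff)

lemma conj_funpow_minus:
  fixes g x :: "'a::group_add"
  shows "((\<lambda>x. g + x - g) ^^ n) (- x) = - ((\<lambda>x. g + x - g) ^^ n) x"
  by (induction n) (simp_all add: diff_conv_add_uminus add.assoc minus_add del: add_uminus_conv_diff)

lemma conj_funpow_zero:
  fixes g :: "'a::group_add"
  shows "((\<lambda>x. g + x - g) ^^ n) 0 = 0"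
  by (induction n) simp_all

lemma continuous_conj_funpow:
  fixes g :: "'a::topological_group_add"
  shows "continuous_on UNIV ((\<lambda>x. g + x - g) ^^ n)"
proof (induction n)
  case (Suc n)
  have "continuous_on UNIV (\<lambda>x. g + ((\<lambda>x. g + x - g) ^^ n) x + - g)"
    by (intro continuous_intros Suc)
  then show ?case by (simp add: o_def)
qed simp

primrec nmult :: "nat \<Rightarrow> 'a::group_add \<Rightarrow> 'a" where
  "nmult 0 g = 0"
| "nmult (Suc n) g = g + nmult n g"

lemma nmult_add: "nmult (m + n) g = nmult m g + nmult n g"
  by (induction m) (simp_all add: add.assoc)

text \<open>Used to collect all multiples of \<open>g\<close> at the right end of a walk: passing
  one of them over \<open>x\<close> costs an iterated conjugation of \<open>x\<close>.\<close>

lemma conj_funpow_nmult: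
  "((\<lambda>x. g + x - g) ^^ n) x + nmult n g = nmult n g + x"
  by (induction n) (simp_all add: diff_conv_add_uminus add.assoc del: add_uminus_conv_diff)

text \<open>The iterates are additive, so the continuous map \<open>d\<close> sends the orbit of the
  pair \<open>(x, y)\<close> to the orbit of \<open>- x + y\<close>, and a diagonal point in the
  closure to \<open>0\<close>.\<close>

lemma not_distal_imp_conj_accumulates_at_zero:
  fixes g :: "'a::{topological_group_add, t2_space}"
  assumes "\<not> distal_action {(\<lambda>x. g + x - g) ^^ n | n :: nat. True}"
  obtains x where "x \<noteq> 0" "0 \<in> closure (range (\<lambda>n. ((\<lambda>x. g + x - g) ^^ n) x))"
proof -
  let ?c = "\<lambda>x. g + x - g"
  obtain x y z where "x \<noteq> y" and z: "(z, z) \<in> closure {(\<gamma> x, \<gamma> y) | \<gamma>. \<gamma> \<in> {?c ^^ n | n :: nat. True}}"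
    using assms unfolding distal_action_def by auto
  define d :: "'a \<times> 'a \<Rightarrow> 'a" where "d = (\<lambda>p. - fst p + snd p)"
  have "continuous_on UNIV d"
    unfolding d_def by (intro continuous_intros)
  then have "d ` closure {(\<gamma> x, \<gamma> y) | \<gamma>. \<gamma> \<in> {?c ^^ n | n :: nat. True}}
      \<subseteq> closure (range (\<lambda>n. (?c ^^ n) (- x + y)))"
    by (intro image_closure_subset)
       (auto simp: d_def conj_funpow_add conj_funpow_minus intro!: closure_subset[THEN subsetD]
             elim: continuous_on_subset)
  with z have "d (z, z) \<in> closure (range (\<lambda>n. (?c ^^ n) (- x + y)))" by blast
  then show ?thesis
    using \<open>x \<noteq> y\<close> by (intro that[of "- x + y"]) (auto simp: d_def add_eq_0_iff)
qed

section \<open>Bump functions and how far translations move them\<close>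

text \<open>The map \<open>m\<close> stands for left and for right translation, so that one proof
  covers both. The tube lemma on \<open>{0} \<times> K\<close> handles the points of
  \<open>K\<close>; outside \<open>K\<close> only those that \<open>u\<close> moves into
  \<open>K\<close> matter.\<close>

lemma compact_support_uniform_continuity:
  fixes \<phi> :: "'a::topological_group_add \<Rightarrow> real" and m :: "'a \<Rightarrow> 'a \<Rightarrow> 'a"
  assumes \<phi>: "continuous_on UNIV \<phi>" and K: "compact K" "\<And>z. z \<notin> K \<Longrightarrow> \<phi> z = 0"
    and m: "continuous_on UNIV (\<lambda>(u, z). m u z)" "\<And>z. m 0 z = z" "\<And>u z. m (- u) (m u z) = z"
    and "e > 0"
  obtains U where "open U" "0 \<in> U" "\<And>u z. u \<in> U \<Longrightarrow> \<bar>\<phi> (m u z) - \<phi> z\<bar> < e"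
proof -
  define W where "W = {p. \<bar>\<phi> (m (fst p) (snd p)) - \<phi> (snd p)\<bar> < e}"
  have m': "continuous_on UNIV (\<lambda>p. m (fst p) (snd p))"
    using m(1) by (simp add: case_prod_beta)
  have "open W"
    unfolding W_def
    by (intro open_Collect_less continuous_intros continuous_on_compose2[OF \<phi>] m') auto
  moreover have "{0} \<times> K \<subseteq> W"
    using \<open>e > 0\<close> by (auto simp: W_def m)
  ultimately obtain X where X: "0 \<in> X" "open X" "X \<times> K \<subseteq> W"
    using Elementary_Topology.tube_lemma[OF K(1)] by metis
  \<comment> \<open>Symmetric, so that for \<open>z\<close> outside \<open>K\<close> with
    \<open>m u z\<close> in \<open>K\<close> the estimate can be applied to the point
    \<open>m u z\<close>, moved back by \<open>- u\<close>.\<close>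
  define U where "U = X \<inter> uminus -` X"
  have near: "\<bar>\<phi> (m u z) - \<phi> z\<bar> < e" if "u \<in> X" "z \<in> K" for u z
    using X(3) that by (auto simp: W_def)
  have "\<bar>\<phi> (m u z) - \<phi> z\<bar> < e" if "u \<in> U" for u z
  proof (cases "z \<in> K")
    case True
    then show ?thesis using that near by (auto simp: U_def)
  next
    case z: False
    show ?thesis
    proof (cases "m u z \<in> K")
      case True
      then have "\<bar>\<phi> (m (- u) (m u z)) - \<phi> (m u z)\<bar> < e"
        using that by (intro near) (auto simp: U_def)
      then show ?thesis by (simp add: m abs_minus_commute)
    next
      case False
      then show ?thesis using z K(2) \<open>e > 0\<close> by simp
    qed
  qed
  moreover have "open U"
    unfolding U_def by (intro open_Int X open_vimage continuous_intros)
  moreover have "0 \<in> U" using X by (simp add: U_def)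
  ultimately show ?thesis using that by blast
qed

text \<open>Locally compact Hausdorff spaces are completely regular. Separating \<open>a\<close>
  from the complement of \<open>U \<inter> O'\<close>, with \<open>U\<close> inside a compact
  \<open>K\<close>, gives both vanishing conditions at once.\<close>

lemma locally_compact_bump_function:
  fixes O' :: "'a::t2_space set"
  assumes "locally_compact_space (euclidean :: 'a topology)" "open O'" "a \<in> O'"
  obtains \<phi> :: "'a \<Rightarrow> real" and K where
    "continuous_on UNIV \<phi>" "\<And>z. 0 \<le> \<phi> z" "\<And>z. \<phi> z \<le> 1" "\<phi> a = 1"
    "compact K" "\<And>z. z \<notin> K \<Longrightarrow> \<phi> z = 0" "\<And>z. z \<notin> O' \<Longrightarrow> \<phi> z = 0"
proof -
  obtain U K where UK: "open U" "compact K" "a \<in> U" "U \<subseteq> K"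
    using assms(1) unfolding locally_compact_space_def by simp metis
  have "Hausdorff_space (euclidean :: 'a topology)"
    unfolding Hausdorff_space_def by (auto simp: disjnt_def) (metis hausdorff)
  then have "completely_regular_space (euclidean :: 'a topology)"
    using assms(1) locally_compact_Hausdorff_imp_regular_space
      locally_compact_regular_imp_completely_regular_space by blast
  moreover have "closedin euclidean (- (U \<inter> O'))" "a \<in> topspace euclidean - (- (U \<inter> O'))"
    using UK assms by (auto simp: closed_def)
  ultimately obtain f :: "'a \<Rightarrow> real" where f: "continuous_map euclidean (top_of_set {0..1}) f"
      "f a = 0" "f ` (- (U \<inter> O')) \<subseteq> {1}"
    unfolding completely_regular_space_def by meson
  have "continuous_on UNIV f" and f01: "f z \<in> {0..1}" for z
    using f(1) by (auto simp: continuous_map_in_subtopology image_subset_iff)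
  show ?thesis
  proof (rule that[of "\<lambda>z. 1 - f z" K])
    show "continuous_on UNIV (\<lambda>z. 1 - f z)"
      by (intro continuous_intros \<open>continuous_on UNIV f\<close>)
    show "0 \<le> 1 - f z" "1 - f z \<le> 1" for z using f01[of z] by auto
    show "1 - f z = 0" if "z \<notin> K" for z using f(3) that UK by (force simp: image_subset_iff)
    show "1 - f z = 0" if "z \<notin> O'" for z using f(3) that UK by (force simp: image_subset_iff)
  qed (use f UK in auto)
qed

text \<open>The sup norm of a right translate minus the function itself. Being subadditive in
  \<open>u\<close>, it serves as a length on a group that carries no metric.\<close>

definition translation_distance :: "('a::group_add \<Rightarrow> real) \<Rightarrow> 'a \<Rightarrow> real" where
  "translation_distance \<phi> u = (SUP z. \<bar>\<phi> (z + u) - \<phi> z\<bar>)"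

context
  fixes \<phi> :: "'a::group_add \<Rightarrow> real"
  assumes \<phi>01: "\<And>z. 0 \<le> \<phi> z" "\<And>z. \<phi> z \<le> 1"
begin

lemma abs_diff_le_1_of_unit_range: "\<bar>\<phi> y - \<phi> z\<bar> \<le> 1"
  using \<phi>01[of y] \<phi>01[of z] by auto

lemma translation_distance_bounds:
  "\<bar>\<phi> (z + u) - \<phi> z\<bar> \<le> translation_distance \<phi> u"
  "0 \<le> translation_distance \<phi> u" "translation_distance \<phi> u \<le> 1"
proof -
  have "bdd_above (range (\<lambda>z. \<bar>\<phi> (z + u) - \<phi> z\<bar>))"
    using abs_diff_le_1_of_unit_range by (intro bdd_aboveI2[of _ _ 1]) auto
  then show 1: "\<bar>\<phi> (z + u) - \<phi> z\<bar> \<le> translation_distance \<phi> u" for z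
    unfolding translation_distance_def by (intro cSUP_upper) auto
  show "0 \<le> translation_distance \<phi> u"
    using 1[of 0] abs_ge_zero order_trans by blast
  show "translation_distance \<phi> u \<le> 1"
    unfolding translation_distance_def by (intro cSUP_least abs_diff_le_1_of_unit_range) auto
qed

lemma translation_distance_add:
  "translation_distance \<phi> (u + v) \<le> translation_distance \<phi> u + translation_distance \<phi> v"
  unfolding translation_distance_def[of \<phi> "u + v"]
proof (rule cSUP_least)
  fix z
  have "\<bar>\<phi> (z + (u + v)) - \<phi> z\<bar> \<le> \<bar>\<phi> (z + u + v) - \<phi> (z + u)\<bar> + \<bar>\<phi> (z + u) - \<phi> z\<bar>"
    by (simp add: add.assoc)
  also have "\<dots> \<le> translation_distance \<phi> v + translation_distance \<phi> u"
    by (intro add_mono translation_distance_bounds)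
  finally show "\<bar>\<phi> (z + (u + v)) - \<phi> z\<bar> \<le> translation_distance \<phi> u + translation_distance \<phi> v"
    by simp
qed simp

end

lemma translation_distance_0: "translation_distance \<phi> 0 = 0"
  by (simp add: translation_distance_def)

section \<open>Repeated maxima in independent samples\<close>

lemma nn_integral_replicate_pmf_Suc:
  "(\<integral>\<^sup>+ xs. f xs \<partial>replicate_pmf (Suc n) p) = (\<integral>\<^sup>+ k. \<integral>\<^sup>+ xs. f (k # xs) \<partial>replicate_pmf n p \<partial>p)"
  by simp

text \<open>For \<open>c > 0\<close> the event says that the maximum is \<open>k\<close> and is
  attained at least \<open>c\<close> times; for \<open>c = 0\<close> only that no entry exceeds
  \<open>k\<close>.\<close>

definition max_prob :: "nat pmf \<Rightarrow> nat \<Rightarrow> nat \<Rightarrow> nat \<Rightarrow> real" where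
  "max_prob p k c n =
     measure_pmf.prob (replicate_pmf n p) {xs. set xs \<subseteq> {..k} \<and> c \<le> count_list xs k}"

lemma max_prob_nonneg: "0 \<le> max_prob p k c n"
  by (simp add: max_prob_def)

text \<open>Condition on the first entry. An entry equal to \<open>k\<close> is counted in both
  terms, hence only an inequality.\<close>

lemma max_prob_Suc:
  "max_prob p k c (Suc n) \<le>
     measure_pmf.prob p {..k} * max_prob p k c n + (if c = 0 then 0 else pmf p k * max_prob p k (c - 1) n)"
proof -
  let ?A = "\<lambda>c. {xs :: nat list. set xs \<subseteq> {..k} \<and> c \<le> count_list xs k}"
  have eq: "emeasure (replicate_pmf n p) (?A c) = ennreal (max_prob p k c n)" for c n
    by (simp add: max_prob_def measure_pmf.emeasure_eq_measure)
  have "ennreal (max_prob p k c (Suc n)) = (\<integral>\<^sup>+ xs. indicator (?A c) xs \<partial>replicate_pmf (Suc n) p)"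
    by (subst nn_integral_indicator) (simp_all add: eq del: replicate_pmf.simps)
  also have "\<dots> = (\<integral>\<^sup>+ i. \<integral>\<^sup>+ xs. indicator (?A c) (i # xs) \<partial>replicate_pmf n p \<partial>p)"
    by (rule nn_integral_replicate_pmf_Suc)
  also have "\<dots> \<le> (\<integral>\<^sup>+ i. indicator {..k} i * ennreal (max_prob p k c n) +
                  indicator {k} i * ennreal (if c = 0 then 0 else max_prob p k (c - 1) n) \<partial>p)"
  proof (intro nn_integral_mono)
    fix i
    have "(\<integral>\<^sup>+ xs. indicator (?A c) (i # xs) \<partial>replicate_pmf n p) \<le>
       (\<integral>\<^sup>+ xs. indicator {..k} i * indicator (?A c) xs +
          indicator {k} i * (if c = 0 then 0 else indicator (?A (c - 1)) xs) \<partial>replicate_pmf n p)"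
      by (intro nn_integral_mono) (auto split: split_indicator)
    also have "\<dots> = indicator {..k} i * ennreal (max_prob p k c n) +
                  indicator {k} i * ennreal (if c = 0 then 0 else max_prob p k (c - 1) n)"
      by (subst nn_integral_add) (auto simp: nn_integral_cmult eq)
    finally show "(\<integral>\<^sup>+ xs. indicator (?A c) (i # xs) \<partial>replicate_pmf n p) \<le> \<dots>" .
  qed
  also have "\<dots> = ennreal (measure_pmf.prob p {..k} * max_prob p k c n +
                    (if c = 0 then 0 else pmf p k * max_prob p k (c - 1) n))"
    by (subst nn_integral_add)
       (auto simp: nn_integral_multc measure_pmf.emeasure_eq_measure measure_pmf_single
          ennreal_mult max_prob_def)
  finally show ?thesis
    by (subst (asm) ennreal_le_iff) (auto simp: max_prob_def)
qed

lemma max_prob_0_le: "max_prob p k 0 n \<le> measure_pmf.prob p {..k} ^ n"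
proof (induction n)
  case (Suc n)
  then show ?case
    using max_prob_Suc[of p k 0 n] mult_left_mono[OF Suc, of "measure_pmf.prob p {..k}"] by simp
qed (simp add: max_prob_def)

text \<open>Summed over \<open>n\<close>, the recursion reads
  \<open>S c \<le> (1 - r) * S c + pmf p k * S (c - 1)\<close>: each further occurrence of
  \<open>k\<close> costs a factor \<open>pmf p k / r\<close>, starting from the geometric series
  \<open>1 / r\<close>. The inner induction on \<open>N\<close> does this for partial sums.\<close>

lemma sum_max_prob_le:
  fixes p :: "nat pmf"
  assumes r: "r = 1 - measure_pmf.prob p {..k}" "r > 0"
  shows "(\<Sum>n<N. max_prob p k c n) \<le> pmf p k ^ c / r ^ Suc c"
proof (induction c arbitrary: N)
  case 0
  show ?case
  proof (induction N)
    case (Suc N)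
    have "(\<Sum>n<Suc N. max_prob p k 0 n) = max_prob p k 0 0 + (\<Sum>n<N. max_prob p k 0 (Suc n))"
      by (rule sum.lessThan_Suc_shift)
    also have "\<dots> \<le> 1 + (\<Sum>n<N. (1 - r) * max_prob p k 0 n)"
      using max_prob_Suc[of p k 0] by (intro add_mono sum_mono) (auto simp: max_prob_def r)
    also have "\<dots> \<le> 1 + (1 - r) * (1 / r)"
      using mult_left_mono[OF Suc, of "1 - r"] r by (simp add: sum_distrib_left)
    also have "\<dots> = 1 / r" using r(2) by (simp add: field_simps)
    finally show ?case by simp
  qed (use r in simp)
next
  case (Suc c)
  note IH = Suc
  show ?case
  proof (induction N)
    case (Suc N)
    have "(\<Sum>n<Suc N. max_prob p k (Suc c) n)
        = max_prob p k (Suc c) 0 + (\<Sum>n<N. max_prob p k (Suc c) (Suc n))"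
      by (rule sum.lessThan_Suc_shift)
    also have "\<dots> \<le> 0 + (\<Sum>n<N. (1 - r) * max_prob p k (Suc c) n + pmf p k * max_prob p k c n)"
      using max_prob_Suc[of p k "Suc c"] by (intro add_mono sum_mono) (auto simp: max_prob_def r)
    also have "\<dots> \<le> (1 - r) * (pmf p k ^ Suc c / r ^ Suc (Suc c)) + pmf p k * (pmf p k ^ c / r ^ Suc c)"
      using mult_left_mono[OF Suc, of "1 - r"] mult_left_mono[OF IH[of N], of "pmf p k"] r
      unfolding sum.distrib sum_distrib_left[symmetric] by simp
    also have "\<dots> = pmf p k ^ Suc c / r ^ Suc (Suc c)" using r(2) by (simp add: field_simps)
    finally show ?case .
  qed (use r in simp)
qed

section \<open>Fast-growing steps and the total cost of the walk\<close>

text \<open>All other entries are below \<open>k\<close>, and each contributes at most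
  \<open>\<Sum>i<k. a i\<close>. So the sum lies in a window after \<open>a k\<close> whose length
  is known before \<open>a k\<close> is chosen.\<close>

lemma sum_list_unique_max:
  fixes a :: "nat \<Rightarrow> nat"
  assumes "set xs \<subseteq> {..k}" "count_list xs k = 1"
  shows "\<exists>s \<le> (length xs - 1) * (\<Sum>i<k. a i). sum_list (map a xs) = a k + s"
proof -
  have small: "sum_list (map a ys) \<le> length ys * (\<Sum>i<k. a i)" if "set ys \<subseteq> {..<k}" for ys
    using that
  proof (induction ys)
    case (Cons y ys)
    then have "a y \<le> (\<Sum>i<k. a i)" by (intro member_le_sum) auto
    with Cons show ?case by (simp add: add_mono)
  qed simp
  have "k \<in> set xs" using assms(2) by (metis count_list_0_iff zero_neq_one)
  then obtain ys zs where xs: "xs = ys @ k # zs" by (meson split_list)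
  with assms(2) have "count_list ys k = 0" "count_list zs k = 0" by auto
  with assms(1) have "set ys \<subseteq> {..<k}" "set zs \<subseteq> {..<k}"
    unfolding xs count_list_0_iff by (auto simp: le_less)
  then show ?thesis
    using small[of ys] small[of zs]
    by (intro exI[of _ "sum_list (map a ys) + sum_list (map a zs)"]) (auto simp: xs algebra_simps)
qed

lemma ex_fast_sequence:
  fixes w :: "nat \<Rightarrow> real"
  assumes "\<And>L e. e > 0 \<Longrightarrow> \<exists>a. \<forall>s\<le>L. w (a + s) < e" and "\<And>k. \<epsilon> k > 0"
  obtains a :: "nat \<Rightarrow> nat" where "a 0 = 0"
    "\<And>k s. k > 0 \<Longrightarrow> s \<le> N k * (\<Sum>i<k. a i) \<Longrightarrow> w (a k + s) < \<epsilon> k"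
proof -
  have "\<forall>L e. \<exists>a. e > 0 \<longrightarrow> (\<forall>s\<le>L. w (a + s) < e)" using assms(1) by blast
  then obtain c where c: "\<And>L e s. e > 0 \<Longrightarrow> s \<le> L \<Longrightarrow> w (c L e + s) < e"
    by metis
  \<comment> \<open>\<open>A k\<close> is the sum of the earlier choices. This is all that the
    choice of \<open>a k\<close> depends on, so recursion on the partial sums suffices.\<close>
  define A where "A = rec_nat 0 (\<lambda>k b. b + (if k = 0 then 0 else c (N k * b) (\<epsilon> k)))"
  define a where "a k = (if k = 0 then 0 else c (N k * A k) (\<epsilon> k))" for k
  have "A k = (\<Sum>i<k. a i)" for k
    by (induction k) (auto simp: A_def a_def)
  then show ?thesis
    using c assms(2) by (intro that[of a]) (auto simp: a_def)
qed

text \<open>The bound is a sum over the maximum \<open>k\<close> of \<open>j # xs\<close>. For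
  \<open>k = j\<close> a single occurrence of \<open>j\<close> in \<open>xs\<close> is already a tie
  with the start, which costs \<open>pmf p j / r j ^ 2\<close>; for \<open>k > j\<close> a tie needs
  two occurrences, which cost \<open>pmf p k ^ 2 / r k ^ 3\<close>. Long walks below the level
  \<open>k\<close> and the small values of \<open>w\<close> cost at most \<open>(1 / 2) ^ k\<close>
  each.\<close>

lemma sum_expectation_random_walk_le:
  fixes w :: "nat \<Rightarrow> real" and p :: "nat pmf" and j :: nat
  defines "r \<equiv> \<lambda>k. 1 - measure_pmf.prob p {..k}"
  assumes w: "\<And>s. 0 \<le> w s" "\<And>s. w s \<le> 1"
    and r: "\<And>k. r k > 0"
    and N: "\<And>k. measure_pmf.prob p {..k} ^ N k \<le> (1 / 2) ^ k * r k"
    and a: "\<And>k s. k > 0 \<Longrightarrow> s \<le> N k * (\<Sum>i<k. a i) \<Longrightarrow> w (a k + s) < (1 / 2) ^ k * r k"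
    and sm: "summable (\<lambda>k. pmf p k ^ 2 / r k ^ 3)" and j: "j > 0"
  shows "(\<Sum>n<M. measure_pmf.expectation (replicate_pmf n p) (\<lambda>xs. w (a j + sum_list (map a xs))))
     \<le> pmf p j / r j ^ 2 + (\<Sum>i. pmf p (i + j) ^ 2 / r (i + j) ^ 3 + 2 * (1 / 2) ^ (i + j))"
proof -
  \<comment> \<open>With \<open>k\<close> the maximum of \<open>j # xs\<close>, the value of \<open>w\<close> is below \<open>(1 / 2) ^ k * r k\<close> unless \<open>k\<close> occurs
    at least twice in \<open>j # xs\<close> or \<open>xs\<close> has length at least \<open>N k\<close>; \<open>T k\<close> charges for these three cases.\<close>
  define c where "c k = (if k = j then 1 else 2 :: nat)" for k
  define B where "B k m = {xs :: nat list. set xs \<subseteq> {..k} \<and> m \<le> count_list xs k}" for k m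
  define T where "T k xs = indicator (B k (c k)) xs + indicator (B k 0) xs *
      ((if N k \<le> length xs then 1 else 0) + ennreal ((1 / 2) ^ k * r k))" for k xs
  define b where "b i = (if i = 0 then pmf p j / r j ^ 2 else 0) +
      (pmf p (i + j) ^ 2 / r (i + j) ^ 3 + 2 * (1 / 2) ^ (i + j))" for i
  have eq: "emeasure (replicate_pmf n p) (B k m) = ennreal (max_prob p k m n)" for k m n
    by (simp add: max_prob_def B_def measure_pmf.emeasure_eq_measure)

  have w_le: "ennreal (w (a j + sum_list (map a xs))) \<le> (\<Sum>i. T (i + j) xs)" for xs
  proof -
    define k where "k = Max (set (j # xs))"
    have k: "k \<in> set (j # xs)" "\<And>i. i \<in> set (j # xs) \<Longrightarrow> i \<le> k"
      unfolding k_def by (rule Max_in, auto)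
    then have "set xs \<subseteq> {..k}" "j \<le> k" by auto
    have cnt: "count_list (j # xs) k \<noteq> 0" using k(1) by (simp only: count_list_0_iff) simp
    have "ennreal (w (a j + sum_list (map a xs))) \<le> T k xs"
    proof (cases "c k \<le> count_list xs k \<or> N k \<le> length xs")
      case True
      then have "1 \<le> T k xs"
        using \<open>set xs \<subseteq> {..k}\<close> by (auto simp: T_def B_def add_increasing add_increasing2)
      then show ?thesis using w(2) by (metis ennreal_le_1 order_trans)
    next
      case False
      have "count_list (j # xs) k = 1"
        using False cnt by (auto simp: c_def split: if_splits)
      then obtain s where s: "s \<le> length xs * (\<Sum>i<k. a i)" "sum_list (map a (j # xs)) = a k + s"
        using sum_list_unique_max[of "j # xs" k a] \<open>set xs \<subseteq> {..k}\<close> \<open>j \<le> k\<close> by auto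
      have "s \<le> N k * (\<Sum>i<k. a i)"
        using s(1) False by (meson le_trans mult_le_mono1 nat_le_linear)
      then have "w (a k + s) < (1 / 2) ^ k * r k" using a \<open>j \<le> k\<close> j by auto
      then show ?thesis
        using s(2) \<open>set xs \<subseteq> {..k}\<close>
        by (auto simp: T_def B_def intro!: add_increasing ennreal_leI)
    qed
    also have "T k xs = (\<Sum>i\<in>{k - j}. T (i + j) xs)" using \<open>j \<le> k\<close> by simp
    also have "\<dots> \<le> (\<Sum>i. T (i + j) xs)" by (intro sum_le_suminf summableI) auto
    finally show ?thesis .
  qed

  have T_le: "(\<Sum>n<M. \<integral>\<^sup>+ xs. T (i + j) xs \<partial>replicate_pmf n p) \<le> ennreal (b i)" for i
  proof -
    define k where "k = i + j"
    define Q where "Q = measure_pmf.prob p {..k}"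
    have Q: "0 \<le> Q" "Q < 1" "r k = 1 - Q" using r[of k] by (auto simp: Q_def r_def)
    have "(\<integral>\<^sup>+ xs. T k xs \<partial>replicate_pmf n p) = ennreal (max_prob p k (c k) n +
        ((if N k \<le> n then max_prob p k 0 n else 0) + (1 / 2) ^ k * r k * max_prob p k 0 n))" for n
    proof -
      have "(\<integral>\<^sup>+ xs. T k xs \<partial>replicate_pmf n p) = (\<integral>\<^sup>+ xs. indicator (B k (c k)) xs + indicator (B k 0) xs *
         ((if N k \<le> n then 1 else 0) + ennreal ((1 / 2) ^ k * r k)) \<partial>replicate_pmf n p)"
        by (intro nn_integral_cong_AE)
           (auto simp: AE_measure_pmf_iff T_def set_replicate_pmf)
      also have "\<dots> = ennreal (max_prob p k (c k) n) + ennreal (max_prob p k 0 n) *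
         ((if N k \<le> n then 1 else 0) + ennreal ((1 / 2) ^ k * r k))"
        by (subst nn_integral_add) (auto simp: nn_integral_multc eq)
      also have "\<dots> = ennreal (max_prob p k (c k) n +
          ((if N k \<le> n then max_prob p k 0 n else 0) + (1 / 2) ^ k * r k * max_prob p k 0 n))"
        using r[of k]
        by (auto simp: max_prob_def ennreal_plus[symmetric] ennreal_mult[symmetric] distrib_left
             mult_ac simp del: ennreal_plus)
      finally show ?thesis .
    qed
    then have "(\<Sum>n<M. \<integral>\<^sup>+ xs. T k xs \<partial>replicate_pmf n p) = ennreal (\<Sum>n<M. max_prob p k (c k) n +
        ((if N k \<le> n then max_prob p k 0 n else 0) + (1 / 2) ^ k * r k * max_prob p k 0 n))"
      using r[of k]
      by (simp add: sum_ennreal max_prob_nonneg less_imp_le del: ennreal_plus)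
    also have "\<dots> \<le> ennreal (b i)"
    proof (rule ennreal_leI)
      have "(\<Sum>n<M. max_prob p k (c k) n) \<le> pmf p k ^ c k / r k ^ Suc (c k)"
        using r[of k] by (intro sum_max_prob_le) (auto simp: r_def)
      also have "\<dots> \<le> (if i = 0 then pmf p j / r j ^ 2 else 0) + pmf p k ^ 2 / r k ^ 3"
        using r[of k] by (auto simp: c_def k_def numeral_eq_Suc)
      finally have 1: "(\<Sum>n<M. max_prob p k (c k) n) \<le> \<dots>" .
      \<comment> \<open>Walks of length at least \<open>N k\<close> that have not exceeded
        \<open>k\<close>: a geometric tail, made small by the choice of \<open>N k\<close>.\<close>
      have "(\<Sum>n<M. if N k \<le> n then max_prob p k 0 n else 0) \<le> (\<Sum>n<M. if N k \<le> n then Q ^ n else 0)"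
        by (intro sum_mono) (auto simp: Q_def max_prob_0_le)
      also have "\<dots> = (\<Sum>n\<in>{N k..<M}. Q ^ n)"
        by (subst sum.inter_filter[symmetric]) (auto intro!: sum.cong)
      also have "\<dots> = Q ^ N k * (\<Sum>n<M - N k. Q ^ n)"
        by (simp add: sum.atLeastLessThan_shift_0[of _ "N k"] lessThan_atLeast0 power_add sum_distrib_left)
      also have "\<dots> \<le> Q ^ N k * (1 / r k)"
        using Q by (intro mult_left_mono) (auto simp: sum_gp_strict intro!: divide_right_mono)
      also have "\<dots> \<le> (1 / 2) ^ k"
        using N[of k] r[of k] by (simp add: Q_def divide_le_eq)
      finally have 2: "(\<Sum>n<M. if N k \<le> n then max_prob p k 0 n else 0) \<le> (1 / 2) ^ k" .
      \<comment> \<open>The expected number of times before \<open>k\<close> is exceeded is at most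
        \<open>1 / r k\<close>; the factor \<open>r k\<close> in the bound on \<open>w\<close>
        compensates for it.\<close>
      have "(\<Sum>n<M. max_prob p k 0 n) \<le> 1 / r k"
        using r[of k] sum_max_prob_le[of "r k" p k 0 M] by (auto simp: r_def)
      then have 3: "(\<Sum>n<M. (1 / 2) ^ k * r k * max_prob p k 0 n) \<le> (1 / 2) ^ k"
        using r[of k] unfolding sum_distrib_left[symmetric] by (simp add: field_simps)
      show "(\<Sum>n<M. max_prob p k (c k) n + ((if N k \<le> n then max_prob p k 0 n else 0) +
          (1 / 2) ^ k * r k * max_prob p k 0 n)) \<le> b i"
        using 1 2 3 unfolding sum.distrib b_def k_def[symmetric] by linarith
    qed
    finally show ?thesis unfolding k_def .
  qed

  have sm': "summable (\<lambda>i. pmf p (i + j) ^ 2 / r (i + j) ^ 3 + 2 * (1 / 2) ^ (i + j))"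
    by (intro summable_add summable_ignore_initial_segment[where k = j] sm summable_mult summable_geometric) simp
  have b0: "b i \<ge> 0" for i using r[of j] r[of "i + j"] by (auto simp: b_def)
  have sums_b: "b sums (pmf p j / r j ^ 2 + (\<Sum>i. pmf p (i + j) ^ 2 / r (i + j) ^ 3 + 2 * (1 / 2) ^ (i + j)))"
    unfolding b_def by (intro sums_add sums_single[of 0] summable_sums sm')

  have expect: "(\<integral>\<^sup>+ xs. ennreal (w (a j + sum_list (map a xs))) \<partial>replicate_pmf n p)
      = ennreal (measure_pmf.expectation (replicate_pmf n p) (\<lambda>xs. w (a j + sum_list (map a xs))))"
    "0 \<le> measure_pmf.expectation (replicate_pmf n p) (\<lambda>xs. w (a j + sum_list (map a xs)))" for n
    using w by (auto intro!: nn_integral_eq_integral measure_pmf.integrable_const_bound[where B = 1]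
        Bochner_Integration.integral_nonneg)
  have "ennreal (\<Sum>n<M. measure_pmf.expectation (replicate_pmf n p) (\<lambda>xs. w (a j + sum_list (map a xs))))
     = (\<Sum>n<M. \<integral>\<^sup>+ xs. ennreal (w (a j + sum_list (map a xs))) \<partial>replicate_pmf n p)"
    by (simp add: sum_ennreal expect)
  also have "\<dots> \<le> (\<Sum>n<M. \<integral>\<^sup>+ xs. (\<Sum>i. T (i + j) xs) \<partial>replicate_pmf n p)"
    by (intro sum_mono nn_integral_mono w_le)
  also have "\<dots> = (\<Sum>i. \<Sum>n<M. \<integral>\<^sup>+ xs. T (i + j) xs \<partial>replicate_pmf n p)"
    by (subst nn_integral_suminf) (auto intro!: suminf_sum[symmetric])
  also have "\<dots> \<le> (\<Sum>i. ennreal (b i))"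
    by (intro suminf_le T_le summableI)
  also have "\<dots> = ennreal (\<Sum>i. b i)"
    using sums_b b0 by (intro suminf_ennreal2) (auto simp: sums_iff)
  finally show ?thesis
    using sums_b b0 by (subst (asm) ennreal_le_iff) (simp_all add: sums_iff, metis suminf_nonneg)
qed

text \<open>
  With \<open>p k\<close> the weights and \<open>r k\<close> the tails, the bound above needs \<open>p k ^ 2 / r k ^ 3\<close> summable and
  \<open>p k / r k ^ 2\<close> null. This forces the tails to decay slowly: among powers \<open>r k \<approx> k powr - s\<close>, those with
  \<open>s < 1\<close> work, and we take \<open>s = 1 / 2\<close>.
\<close>

definition slow_pmf :: "nat pmf" where
  "slow_pmf = embed_pmf (\<lambda>k. 1 / sqrt (real k + 1) - 1 / sqrt (real k + 2))"

lemma pmf_slow_pmf: "pmf slow_pmf k = 1 / sqrt (real k + 1) - 1 / sqrt (real k + 2)"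
proof -
  let ?f = "\<lambda>k. 1 / sqrt (real k + 1) - 1 / sqrt (real k + 2)"
  have nn: "?f k \<ge> 0" for k by (simp add: frac_le)
  have "(\<lambda>k. 1 / sqrt (real k + 1)) \<longlonglongrightarrow> 0" by real_asymp
  then have "(\<lambda>k. 1 / sqrt (real k + 1) - 1 / sqrt (real (Suc k) + 1)) sums (1 / sqrt (real 0 + 1) - 0)"
    by (rule telescope_sums')
  then have "?f sums 1" by (simp add: add.commute add.left_commute)
  then have "(\<Sum>k. ennreal (?f k)) = ennreal 1"
    using nn by (subst suminf_ennreal2) (auto simp: sums_iff)
  then show ?thesis
    unfolding slow_pmf_def by (intro pmf_embed_pmf nn) (simp add: nn_integral_count_space_nat)
qed

lemma prob_slow_pmf_atMost: "measure_pmf.prob slow_pmf {..k} = 1 - 1 / sqrt (real k + 2)"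
  by (subst measure_measure_pmf_finite) (simp, induction k, simp_all add: pmf_slow_pmf add_ac)

text \<open>The cost bound depends on \<open>p\<close> and \<open>j\<close> only, so
  \<open>j\<close> can be fixed before \<open>N\<close> and \<open>a\<close>. Full support of
  \<open>p\<close> and \<open>a 0 = 0\<close> serve later to place two points in the subgroup
  generated by the support.\<close>

lemma ex_transient_random_walk:
  fixes w :: "nat \<Rightarrow> real"
  assumes w: "\<And>s. 0 \<le> w s" "\<And>s. w s \<le> 1"
    and small: "\<And>L e. e > 0 \<Longrightarrow> \<exists>a. \<forall>s\<le>L. w (a + s) < e" and "\<delta> > 0"
  obtains p :: "nat pmf" and a :: "nat \<Rightarrow> nat" and j where "set_pmf p = UNIV" "a 0 = 0"
    "\<And>M. (\<Sum>n<M. measure_pmf.expectation (replicate_pmf n p) (\<lambda>xs. w (a j + sum_list (map a xs)))) < \<delta>"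
proof -
  define p where "p = slow_pmf"
  define r where "r k = 1 - measure_pmf.prob p {..k}" for k
  have r: "r k = 1 / sqrt (real k + 2)" "r k > 0" for k
    by (simp_all add: r_def p_def prob_slow_pmf_atMost add_pos_nonneg)
  have "(\<lambda>k. pmf p k ^ 2 / r k ^ 3) \<in> O(\<lambda>k. real k powr (- 3 / 2))"
    unfolding p_def pmf_slow_pmf r by real_asymp
  then have sm: "summable (\<lambda>k. pmf p k ^ 2 / r k ^ 3)"
    by (rule summable_comparison_test_bigo[rotated]) (simp add: summable_real_powr_iff)
  have "summable (\<lambda>k. pmf p k ^ 2 / r k ^ 3 + 2 * (1 / 2) ^ k)"
    by (intro summable_add sm summable_mult summable_geometric) simp
  from suminf_exist_split[OF _ this, of "\<delta> / 2"] obtain J where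
    J: "\<And>j. j \<ge> J \<Longrightarrow> norm (\<Sum>i. pmf p (i + j) ^ 2 / r (i + j) ^ 3 + 2 * (1 / 2) ^ (i + j)) < \<delta> / 2"
    using \<open>\<delta> > 0\<close> by auto
  have "(\<lambda>j. pmf p j / r j ^ 2) \<longlonglongrightarrow> 0"
    unfolding p_def pmf_slow_pmf r by real_asymp
  then have "\<forall>\<^sub>F j in sequentially. pmf p j / r j ^ 2 < \<delta> / 2"
    using \<open>\<delta> > 0\<close> by (intro order_tendstoD) auto
  then have "\<forall>\<^sub>F j in sequentially. pmf p j / r j ^ 2 < \<delta> / 2 \<and> j \<ge> J \<and> j > 0"
    using eventually_ge_at_top[of J] eventually_gt_at_top[of 0] by eventually_elim auto
  then obtain j where j: "pmf p j / r j ^ 2 < \<delta> / 2" "j \<ge> J" "j > 0"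
    by (auto simp: eventually_sequentially)

  have "\<exists>N. measure_pmf.prob p {..k} ^ N \<le> (1 / 2) ^ k * r k" for k
    using r(2)[of k] real_arch_pow_inv[of "(1 / 2) ^ k * r k" "measure_pmf.prob p {..k}"]
    by (simp add: r_def) (meson less_imp_le)
  then obtain N where N: "\<And>k. measure_pmf.prob p {..k} ^ N k \<le> (1 / 2) ^ k * r k" by metis
  obtain a where a: "a 0 = 0"
    "\<And>k s. k > 0 \<Longrightarrow> s \<le> N k * (\<Sum>i<k. a i) \<Longrightarrow> w (a k + s) < (1 / 2) ^ k * r k"
    by (rule ex_fast_sequence[of w "\<lambda>k. (1 / 2) ^ k * r k" N]) (use small r in auto)
  show ?thesis
  proof (rule that[of p a j])
    have "pmf p k > 0" for k
      by (simp add: p_def pmf_slow_pmf frac_less2)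
    then show "set_pmf p = UNIV" by (auto simp: set_pmf_iff less_imp_neq[symmetric])
    fix M
    have "(\<Sum>n<M. measure_pmf.expectation (replicate_pmf n p) (\<lambda>xs. w (a j + sum_list (map a xs))))
        \<le> pmf p j / r j ^ 2 + (\<Sum>i. pmf p (i + j) ^ 2 / r (i + j) ^ 3 + 2 * (1 / 2) ^ (i + j))"
      by (rule sum_expectation_random_walk_le[where N = N and p = p, folded r_def])
         (use w r(2) N a(2) sm j(3) in auto)
    also have "\<dots> < \<delta>" using j(1) J[OF j(2)] unfolding real_norm_def by linarith
    finally show "(\<Sum>n<M. measure_pmf.expectation (replicate_pmf n p) (\<lambda>xs. w (a j + sum_list (map a xs)))) < \<delta>" .
  qed fact
qed

section \<open>Expectations over independent samples and their limits\<close>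

lemma integrable_pmf_bounded:
  fixes f :: "'b \<Rightarrow> real"
  assumes "\<And>x. 0 \<le> f x" "\<And>x. f x \<le> 1"
  shows "integrable (measure_pmf p) f"
  using assms by (intro measure_pmf.integrable_const_bound[where B = 1]) auto

lemma expectation_pmf_bounds:
  fixes f :: "'b \<Rightarrow> real"
  assumes "\<And>x. 0 \<le> f x" "\<And>x. f x \<le> 1"
  shows "0 \<le> measure_pmf.expectation p f" "measure_pmf.expectation p f \<le> 1"
  using assms integrable_pmf_bounded[of f p]
  by (auto intro!: Bochner_Integration.integral_nonneg measure_pmf.integral_le_const)

lemma expectation_replicate_pmf_Suc:
  fixes f :: "'b list \<Rightarrow> real"
  assumes f: "\<And>xs. 0 \<le> f xs" "\<And>xs. f xs \<le> 1"
  shows "measure_pmf.expectation (replicate_pmf (Suc n) p) f =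
    measure_pmf.expectation p (\<lambda>k. measure_pmf.expectation (replicate_pmf n p) (\<lambda>xs. f (k # xs)))"
proof -
  have nn: "(\<integral>\<^sup>+ x. ennreal (g x) \<partial>measure_pmf q) = ennreal (measure_pmf.expectation q g)"
    if "\<And>x. 0 \<le> g x" "\<And>x. g x \<le> 1" for q :: "'c pmf" and g :: "'c \<Rightarrow> real"
    using that by (intro nn_integral_eq_integral integrable_pmf_bounded) auto
  have "ennreal (measure_pmf.expectation (replicate_pmf (Suc n) p) f)
      = (\<integral>\<^sup>+ k. \<integral>\<^sup>+ xs. ennreal (f (k # xs)) \<partial>replicate_pmf n p \<partial>p)"
    using f by (subst nn[symmetric]) simp_all
  also have "\<dots> = ennreal (measure_pmf.expectation p
      (\<lambda>k. measure_pmf.expectation (replicate_pmf n p) (\<lambda>xs. f (k # xs))))"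
    using f by (simp add: nn expectation_pmf_bounds)
  finally show ?thesis
    using f by (subst (asm) ennreal_inj) (auto intro!: expectation_pmf_bounds)
qed

lemma expectation_replicate_pmf_take:
  fixes f :: "'b list \<Rightarrow> real"
  assumes f: "\<And>xs. 0 \<le> f xs" "\<And>xs. f xs \<le> 1" and "i \<le> n"
  shows "measure_pmf.expectation (replicate_pmf n p) (\<lambda>xs. f (take i xs)) =
    measure_pmf.expectation (replicate_pmf i p) f"
  using assms
proof (induction i arbitrary: n f)
  case (Suc i)
  then obtain m where "n = Suc m" "i \<le> m" by (cases n) auto
  have "measure_pmf.expectation (replicate_pmf m p) (\<lambda>xs. f (k # take i xs)) =
      measure_pmf.expectation (replicate_pmf i p) (\<lambda>xs. f (k # xs))" for k
    using Suc.prems \<open>i \<le> m\<close> by (intro Suc.IH[of "\<lambda>xs. f (k # xs)"])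
  then show ?case
    using Suc.prems(1,2) \<open>n = Suc m\<close>
    by (simp add: expectation_replicate_pmf_Suc del: replicate_pmf.simps)
qed simp

text \<open>The limit is along an arbitrary filter, so dominated convergence of sequences is
  replaced by truncation: some \<open>{..<L}\<close> carries all but \<open>e / 2\<close> of the
  mass, and only finitely many coordinates remain.\<close>

lemma tendsto_expectation_pmf_nat:
  fixes g :: "'i \<Rightarrow> nat \<Rightarrow> real"
  assumes g: "\<And>n k. 0 \<le> g n k" "\<And>n k. g n k \<le> 1" and l: "\<And>k. 0 \<le> l k" "\<And>k. l k \<le> 1"
    and lim: "\<And>k. ((\<lambda>n. g n k) \<longlongrightarrow> l k) F"
  shows "((\<lambda>n. measure_pmf.expectation p (g n)) \<longlongrightarrow> measure_pmf.expectation p l) F"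
proof (rule tendstoI)
  fix e :: real assume "e > 0"
  have "(\<lambda>L. measure_pmf.prob p {..<L}) \<longlonglongrightarrow> measure_pmf.prob p (\<Union>L. {..<L})"
    by (intro measure_pmf.finite_Lim_measure_incseq) (auto simp: incseq_def)
  moreover have "(\<Union>L. {..<L}) = (UNIV :: nat set)" by auto
  ultimately have "(\<lambda>L. measure_pmf.prob p {..<L}) \<longlonglongrightarrow> 1" by simp
  then have "\<forall>\<^sub>F L in sequentially. measure_pmf.prob p {..<L} > 1 - e / 2"
    using \<open>e > 0\<close> by (intro order_tendstoD) auto
  then obtain L where L: "measure_pmf.prob p {..<L} > 1 - e / 2"
    by (auto simp: eventually_sequentially)
  have "measure_pmf.prob p {L..} = 1 - measure_pmf.prob p {..<L}"
    by (subst measure_pmf.prob_compl[symmetric]) (auto intro!: arg_cong[where f = "measure p"])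
  with L have tail: "measure_pmf.prob p {L..} < e / 2" by simp
  have "((\<lambda>n. \<Sum>k<L. \<bar>g n k - l k\<bar>) \<longlongrightarrow> (\<Sum>k<L. \<bar>l k - l k\<bar>)) F"
    by (intro tendsto_intros lim)
  then have "\<forall>\<^sub>F n in F. (\<Sum>k<L. \<bar>g n k - l k\<bar>) < e / 2"
    using \<open>e > 0\<close> by (intro order_tendstoD) auto
  then show "\<forall>\<^sub>F n in F. dist (measure_pmf.expectation p (g n)) (measure_pmf.expectation p l) < e"
  proof eventually_elim
    case (elim n)
    have diff: "\<bar>g n k - l k\<bar> \<le> 1" for k using g[of n k] l[of k] by auto
    have "\<bar>measure_pmf.expectation p (g n) - measure_pmf.expectation p l\<bar>
        = \<bar>measure_pmf.expectation p (\<lambda>k. g n k - l k)\<bar>"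
      using g l by (subst Bochner_Integration.integral_diff) (auto intro!: integrable_pmf_bounded)
    also have "\<dots> \<le> measure_pmf.expectation p (\<lambda>k. \<bar>g n k - l k\<bar>)"
      by (rule integral_abs_bound)
    also have "\<dots> \<le> measure_pmf.expectation p (\<lambda>k. (\<Sum>i<L. \<bar>g n i - l i\<bar>) + indicator {L..} k)"
    proof (rule integral_mono)
      show "integrable p (\<lambda>k. \<bar>g n k - l k\<bar>)"
        using diff by (intro integrable_pmf_bounded) auto
      show "integrable p (\<lambda>k. (\<Sum>i<L. \<bar>g n i - l i\<bar>) + indicator {L..} k)"
        by (intro Bochner_Integration.integrable_add integrable_pmf_bounded[of "indicator {L..}"]) auto
      fix k
      show "\<bar>g n k - l k\<bar> \<le> (\<Sum>i<L. \<bar>g n i - l i\<bar>) + indicator {L..} k"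
      proof (cases "k < L")
        case True
        then have "\<bar>g n k - l k\<bar> \<le> (\<Sum>i<L. \<bar>g n i - l i\<bar>)" by (intro member_le_sum) auto
        then show ?thesis by (simp add: add_increasing2)
      next
        case False
        then show ?thesis using diff[of k] by (simp add: add_increasing sum_nonneg)
      qed
    qed
    also have "\<dots> = (\<Sum>i<L. \<bar>g n i - l i\<bar>) + measure_pmf.prob p {L..}"
      by (subst Bochner_Integration.integral_add) (auto simp: integrable_pmf_bounded)
    finally show ?case using elim tail by (simp add: dist_real_def)
  qed
qed

section \<open>Harmonic functions as limits of Cesaro means\<close>

text \<open>By Tychonoff the functions into \<open>{0..1}\<close> form a compact space, so the
  sequence has a cluster point. On an uncountable group a convergent subsequence may not exist; a
  finer filter does.\<close>

lemma ex_pointwise_convergent_subfilter: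
  fixes \<Phi> :: "nat \<Rightarrow> 'a \<Rightarrow> real"
  assumes "\<And>n y. 0 \<le> \<Phi> n y" "\<And>n y. \<Phi> n y \<le> 1"
  obtains f F where "F \<noteq> bot" "F \<le> sequentially" "\<And>y. ((\<lambda>n. \<Phi> n y) \<longlongrightarrow> f y) F"
proof -
  have "compact (PiE UNIV (\<lambda>_. {0..1}) :: ('a \<Rightarrow> real) set)"
    using compactin_PiE[of "\<lambda>_. euclidean" "UNIV :: 'a set" "\<lambda>_. {0..1} :: real set"]
    by (simp add: euclidean_product_topology)
  moreover have "filtermap \<Phi> sequentially \<noteq> bot" by (simp add: filtermap_bot_iff)
  moreover have "\<forall>\<^sub>F x in filtermap \<Phi> sequentially. x \<in> PiE UNIV (\<lambda>_. {0..1})"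
    using assms by (auto simp: eventually_filtermap PiE_iff intro!: always_eventually)
  ultimately obtain f where f: "inf (nhds f) (filtermap \<Phi> sequentially) \<noteq> bot"
    unfolding compact_filter by blast
  \<comment> \<open>Generated by the tails of the sequence and the sets of indices at which \<Phi>
    is close to \<open>f\<close>; it is proper because \<open>f\<close> is a cluster point.\<close>
  define F where "F = inf sequentially (filtercomap \<Phi> (nhds f))"
  have "F \<noteq> bot"
  proof
    assume "F = bot"
    then have "eventually (\<lambda>_. False) F" by simp
    then obtain P R where PR: "eventually P sequentially" "eventually R (nhds f)"
        "\<And>n. P n \<Longrightarrow> R (\<Phi> n) \<Longrightarrow> False"
      unfolding F_def eventually_inf eventually_filtercomap by blast
    have "eventually (\<lambda>x. \<not> R x) (filtermap \<Phi> sequentially)"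
      unfolding eventually_filtermap using PR(1) by eventually_elim (use PR(3) in blast)
    with PR(2) have "eventually (\<lambda>_. False) (inf (nhds f) (filtermap \<Phi> sequentially))"
      unfolding eventually_inf by blast
    with f show False by (simp add: eventually_False)
  qed
  moreover have "F \<le> sequentially" by (simp add: F_def)
  moreover have "((\<lambda>n. \<Phi> n y) \<longlongrightarrow> f y) F" for y
  proof -
    have "filterlim \<Phi> (nhds f) F"
      unfolding F_def by (intro filterlim_mono[OF filterlim_filtercomap]) auto
    moreover have "((\<lambda>x. x y) \<longlongrightarrow> f y) (nhds f)"
    proof -
      have "continuous_on UNIV (\<lambda>x :: 'a \<Rightarrow> real. x y)"
        by (rule continuous_on_product_coordinates)
      then show ?thesis
        using tendsto_at_iff_tendsto_nhds[of "\<lambda>x. x y" f] by (simp add: continuous_on_def)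
    qed
    ultimately show ?thesis by (rule filterlim_compose[rotated])
  qed
  ultimately show ?thesis using that by blast
qed

definition walk_expectation ::
  "nat pmf \<Rightarrow> (nat \<Rightarrow> 'a::monoid_add) \<Rightarrow> ('a \<Rightarrow> real) \<Rightarrow> nat \<Rightarrow> 'a \<Rightarrow> real" where
  "walk_expectation p h F n y =
     measure_pmf.expectation (replicate_pmf n p) (\<lambda>xs. F (y + sum_list (map h xs)))"

text \<open>One more step changes a Cesaro mean by a telescoping difference of size at most
  \<open>1 / real (Suc n)\<close>, so the limit is harmonic. The walk adds its steps on the right,
  so the modulus of \<open>F\<close> under left translation passes to all expectations, to their
  means and to the limit.\<close>

lemma ex_harmonic_limit:
  fixes F :: "'a::topological_group_add \<Rightarrow> real"
  assumes F: "\<And>y. 0 \<le> F y" "\<And>y. F y \<le> 1"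
    and unif: "\<And>e. e > 0 \<Longrightarrow> \<exists>U. open U \<and> 0 \<in> U \<and> (\<forall>u\<in>U. \<forall>z. \<bar>F (u + z) - F z\<bar> < e)"
  obtains f where "continuous_on UNIV f" "\<And>y. 0 \<le> f y" "\<And>y. f y \<le> 1"
    "\<And>y. f y = measure_pmf.expectation p (\<lambda>k. f (y + h k))"
    "\<And>y c. \<forall>n. c \<le> walk_expectation p h F n y \<Longrightarrow> c \<le> f y"
    "\<And>y c. \<forall>n. walk_expectation p h F n y \<le> c \<Longrightarrow> f y \<le> c"
proof -
  define E where "E = walk_expectation p h F"
  define \<Phi> where "\<Phi> n y = (\<Sum>i<Suc n. E i y) / real (Suc n)" for n y
  have E01: "0 \<le> E n y" "E n y \<le> 1" for n y
    using F by (auto simp: E_def walk_expectation_def intro!: expectation_pmf_bounds)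
  have E_Suc: "E (Suc n) y = measure_pmf.expectation p (\<lambda>k. E n (y + h k))" for n y
    unfolding E_def walk_expectation_def
    using F by (subst expectation_replicate_pmf_Suc) (simp_all add: add.assoc)
  have \<Phi>_ge: "c \<le> \<Phi> n y" if "\<And>n. c \<le> E n y" for c n y
    using sum_mono[of "{..<Suc n}" "\<lambda>_. c" "\<lambda>i. E i y"] that
    by (simp add: \<Phi>_def pos_le_divide_eq mult.commute del: sum.lessThan_Suc)
  have \<Phi>_le: "\<Phi> n y \<le> c" if "\<And>n. E n y \<le> c" for c n y
    using sum_mono[of "{..<Suc n}" "\<lambda>i. E i y" "\<lambda>_. c"] that
    by (simp add: \<Phi>_def pos_divide_le_eq mult.commute del: sum.lessThan_Suc)
  have \<Phi>01: "0 \<le> \<Phi> n y" "\<Phi> n y \<le> 1" for n y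
    by (intro \<Phi>_ge E01, intro \<Phi>_le E01)
  obtain f G where G: "G \<noteq> bot" "G \<le> sequentially" and f: "\<And>y. ((\<lambda>n. \<Phi> n y) \<longlongrightarrow> f y) G"
    by (rule ex_pointwise_convergent_subfilter[of \<Phi>, OF \<Phi>01], rule that)
  have f_ge: "c \<le> f y" if "\<And>n. c \<le> \<Phi> n y" for c y
    using that by (intro tendsto_lowerbound[OF f _ G(1)]) auto
  have f_le: "f y \<le> c" if "\<And>n. \<Phi> n y \<le> c" for c y
    using that by (intro tendsto_upperbound[OF f _ G(1)]) auto
  have f01: "0 \<le> f y" "f y \<le> 1" for y
    by (intro f_ge \<Phi>01, intro f_le \<Phi>01)

  have harmonic: "f y = measure_pmf.expectation p (\<lambda>k. f (y + h k))" for y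
  proof (rule tendsto_unique[OF G(1) f])
    have "measure_pmf.expectation p (\<lambda>k. \<Phi> n (y + h k)) = (\<Sum>i<Suc n. E (Suc i) y) / real (Suc n)" for n
      unfolding \<Phi>_def E_Suc using E01
      by (simp add: Bochner_Integration.integral_sum integrable_pmf_bounded del: sum.lessThan_Suc)
    moreover have "(\<Sum>i<Suc n. E (Suc i) y) = (\<Sum>i<Suc n. E i y) + (E (Suc n) y - E 0 y)" for n
      using sum_lessThan_telescope[of "\<lambda>i. E i y" "Suc n"]
      by (simp only: sum_subtractf)
    ultimately have shift: "\<Phi> n y = measure_pmf.expectation p (\<lambda>k. \<Phi> n (y + h k))
        - (E (Suc n) y - E 0 y) / real (Suc n)" for n
      by (simp add: \<Phi>_def add_divide_distrib diff_divide_distrib del: sum.lessThan_Suc)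
    have "((\<lambda>n. (E (Suc n) y - E 0 y) * (1 / real (Suc n))) \<longlonglongrightarrow> 0)"
    proof (rule Lim_null_comparison)
      show "(\<lambda>n. 1 / real (Suc n)) \<longlonglongrightarrow> 0"
        by (rule LIMSEQ_Suc[OF lim_1_over_n])
      have "\<bar>E (Suc n) y - E 0 y\<bar> \<le> 1" for n
        using E01[of "Suc n" y] E01[of 0 y] by auto
      then show "\<forall>\<^sub>F n in sequentially. norm ((E (Suc n) y - E 0 y) * (1 / real (Suc n))) \<le> 1 / real (Suc n)"
        by (auto intro!: always_eventually simp: abs_mult divide_right_mono)
    qed
    then have "((\<lambda>n. (E (Suc n) y - E 0 y) / real (Suc n)) \<longlongrightarrow> 0) G"
      by (intro filterlim_mono[OF _ order_refl G(2)]) simp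
    then have "((\<lambda>n. measure_pmf.expectation p (\<lambda>k. \<Phi> n (y + h k))
        - (E (Suc n) y - E 0 y) / real (Suc n)) \<longlongrightarrow> measure_pmf.expectation p (\<lambda>k. f (y + h k)) - 0) G"
      by (intro tendsto_diff tendsto_expectation_pmf_nat \<Phi>01 f01 f)
    then show "((\<lambda>n. \<Phi> n y) \<longlongrightarrow> measure_pmf.expectation p (\<lambda>k. f (y + h k))) G"
      by (subst shift) simp
  qed

  have cont: "continuous_on UNIV f"
  proof -
    have "\<exists>U. open U \<and> 0 \<in> U \<and> (\<forall>u\<in>U. \<forall>y. \<bar>f (u + y) - f y\<bar> < e)" if "e > 0" for e
    proof -
      \<comment> \<open>Half of \<open>e\<close>, since only a weak inequality survives the
        limit.\<close>
      obtain U where U: "open U" "0 \<in> U" "\<And>u z. u \<in> U \<Longrightarrow> \<bar>F (u + z) - F z\<bar> < e / 2"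
        using unif[of "e / 2"] \<open>e > 0\<close> by auto
      have "\<bar>f (u + y) - f y\<bar> < e" if "u \<in> U" for u y
      proof -
        have E_le: "\<bar>E n (u + y) - E n y\<bar> \<le> e / 2" for n
        proof -
          have "\<bar>E n (u + y) - E n y\<bar> = \<bar>measure_pmf.expectation (replicate_pmf n p)
              (\<lambda>xs. F (u + (y + sum_list (map h xs))) - F (y + sum_list (map h xs)))\<bar>"
            unfolding E_def walk_expectation_def
            by (subst Bochner_Integration.integral_diff)
               (simp_all add: integrable_pmf_bounded F add.assoc)
          also have "\<dots> \<le> measure_pmf.expectation (replicate_pmf n p)
              (\<lambda>xs. \<bar>F (u + (y + sum_list (map h xs))) - F (y + sum_list (map h xs))\<bar>)"
            by (rule integral_abs_bound)
          also have "\<dots> \<le> e / 2"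
          proof (intro measure_pmf.integral_le_const measure_pmf.integrable_const_bound[where B = "e / 2"])
            show "AE xs in replicate_pmf n p.
                norm \<bar>F (u + (y + sum_list (map h xs))) - F (y + sum_list (map h xs))\<bar> \<le> e / 2"
              by (rule AE_I2) (simp only: real_norm_def abs_abs less_imp_le[OF U(3)[OF that]])
            show "AE xs in replicate_pmf n p.
                \<bar>F (u + (y + sum_list (map h xs))) - F (y + sum_list (map h xs))\<bar> \<le> e / 2"
              by (rule AE_I2) (rule less_imp_le[OF U(3)[OF that]])
          qed simp
          finally show ?thesis .
        qed
        have "\<bar>\<Phi> n (u + y) - \<Phi> n y\<bar> \<le> e / 2" for n
        proof -
          have "\<bar>\<Phi> n (u + y) - \<Phi> n y\<bar> = \<bar>\<Sum>i<Suc n. E i (u + y) - E i y\<bar> / real (Suc n)"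
            by (simp add: \<Phi>_def sum_subtractf flip: diff_divide_distrib del: sum.lessThan_Suc)
          also have "\<dots> \<le> (\<Sum>i<Suc n. \<bar>E i (u + y) - E i y\<bar>) / real (Suc n)"
            by (intro divide_right_mono sum_abs) auto
          also have "\<dots> \<le> (\<Sum>i<Suc n. e / 2) / real (Suc n)"
            by (intro divide_right_mono sum_mono E_le) auto
          also have "\<dots> = e / 2" by (simp add: field_simps)
          finally show ?thesis .
        qed
        then have "\<bar>f (u + y) - f y\<bar> \<le> e / 2"
          by (intro tendsto_upperbound[OF tendsto_rabs[OF tendsto_diff[OF f f]] _ G(1)]) auto
        then show ?thesis using \<open>e > 0\<close> by simp
      qed
      with U show ?thesis by blast
    qed
    note equi = this
    show ?thesis
      unfolding continuous_on_def
    proof (intro ballI tendstoI)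
      fix e :: real and y :: 'a assume "e > 0"
      from equi[OF this] obtain U where U: "open U" "0 \<in> U" "\<forall>u\<in>U. \<forall>y. \<bar>f (u + y) - f y\<bar> < e"
        by (elim exE conjE)
      have "open ((\<lambda>z. z + - y) -` U)"
        by (intro open_vimage U(1) continuous_intros)
      then have "\<forall>\<^sub>F z in nhds y. z \<in> (\<lambda>z. z + - y) -` U"
        by (rule eventually_nhds_in_open) (simp add: U(2))
      then have "\<forall>\<^sub>F z in nhds y. dist (f z) (f y) < e"
      proof eventually_elim
        case (elim z)
        then have "\<bar>f (z + - y + y) - f y\<bar> < e" using U(3) by blast
        then show ?case by (simp add: dist_real_def add.assoc)
      qed
      then show "\<forall>\<^sub>F z in at y. dist (f z) (f y) < e"
        unfolding eventually_at_filter by eventually_elim simp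
    qed
  qed
  show ?thesis
  proof (rule that[OF cont f01 harmonic])
    show "c \<le> f y" if "\<forall>n. c \<le> walk_expectation p h F n y" for y c
      using that by (intro f_ge \<Phi>_ge) (simp add: E_def)
    show "f y \<le> c" if "\<forall>n. walk_expectation p h F n y \<le> c" for y c
      using that by (intro f_le \<Phi>_le) (simp add: E_def)
  qed
qed

section \<open>Discrete measures on the group\<close>

text \<open>All mass sits on countably many atoms. Finitely many atoms in \<open>A\<close> form a
  compact set with nearly the measure of \<open>A\<close>; removing finitely many atoms outside
  \<open>A\<close> from the space leaves an open superset of nearly the same measure.\<close>

lemma distr_pmf_nat_regular:
  fixes h :: "nat \<Rightarrow> 'a::t2_space"
  shows "distr (measure_pmf p) borel h \<in> regular_prob_measures"
proof -
  define M where "M = distr (measure_pmf p) borel h"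
  have M: "emeasure M A = emeasure p (h -` A)" if "A \<in> sets borel" for A
    using that by (simp add: M_def emeasure_distr)
  define K where "K A n = h ` {k. k < n \<and> h k \<in> A}" for A :: "'a set" and n :: nat
  have K: "compact (K A n)" "K A n \<subseteq> A" "closed (K A n)" for A n
    by (auto simp: K_def finite_imp_compact finite_imp_closed)
  have union: "(\<Union>n. {k. k < n \<and> h k \<in> A}) = h -` A" for A by auto
  have inner: "emeasure M A = (SUP K \<in> {K. compact K \<and> K \<subseteq> A}. emeasure M K)" if A: "A \<in> sets borel" for A
  proof (rule antisym)
    have "emeasure M A = (SUP n. emeasure p {k. k < n \<and> h k \<in> A})"
      unfolding M[OF A] union[symmetric]
      by (intro SUP_emeasure_incseq[symmetric]) (auto simp: incseq_def)
    also have "\<dots> \<le> (SUP K \<in> {K. compact K \<and> K \<subseteq> A}. emeasure M K)"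
    proof (intro SUP_mono)
      fix n
      have "emeasure p {k. k < n \<and> h k \<in> A} \<le> emeasure M (K A n)"
        using K(3)[of A n] by (subst M) (auto simp: K_def intro!: emeasure_mono)
      then show "\<exists>m\<in>{K. compact K \<and> K \<subseteq> A}. emeasure p {k. k < n \<and> h k \<in> A} \<le> emeasure M m"
        using K by blast
    qed
    finally show "emeasure M A \<le> \<dots>" .
    show "(SUP K \<in> {K. compact K \<and> K \<subseteq> A}. emeasure M K) \<le> emeasure M A"
      using A by (intro SUP_least emeasure_mono) (auto simp: M_def)
  qed
  have outer: "emeasure M A = (INF U \<in> {U. open U \<and> A \<subseteq> U}. emeasure M U)" if A: "A \<in> sets borel" for A
  proof (rule antisym)
    show "emeasure M A \<le> (INF U \<in> {U. open U \<and> A \<subseteq> U}. emeasure M U)"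
      by (intro INF_greatest emeasure_mono) (auto simp: M_def)
    show "(INF U \<in> {U. open U \<and> A \<subseteq> U}. emeasure M U) \<le> emeasure M A"
    proof (rule ennreal_le_epsilon)
      fix e :: real assume "e > 0"
      have "(\<lambda>n. measure_pmf.prob p {k. k < n \<and> h k \<in> - A}) \<longlonglongrightarrow>
          measure_pmf.prob p (\<Union>n. {k. k < n \<and> h k \<in> - A})"
        by (intro measure_pmf.finite_Lim_measure_incseq) (auto simp: incseq_def)
      then have "\<forall>\<^sub>F n in sequentially. measure_pmf.prob p {k. k < n \<and> h k \<in> - A} >
          measure_pmf.prob p (h -` (- A)) - e"
        unfolding union using \<open>e > 0\<close> by (intro order_tendstoD) auto
      then obtain n where n: "measure_pmf.prob p (h -` (- A)) - e < measure_pmf.prob p {k. k < n \<and> h k \<in> - A}"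
        by (auto simp: eventually_sequentially)
      have compl: "measure_pmf.prob p (h -` (- B)) = 1 - measure_pmf.prob p (h -` B)" for B
        by (subst measure_pmf.prob_compl[symmetric]) (auto intro!: arg_cong[where f = "measure p"])
      have "measure_pmf.prob p {k. k < n \<and> h k \<in> - A} \<le> measure_pmf.prob p (h -` K (- A) n)"
        by (intro measure_pmf.finite_measure_mono) (auto simp: K_def)
      with n have "measure_pmf.prob p (h -` (- K (- A) n)) \<le> measure_pmf.prob p (h -` A) + e"
        unfolding compl by linarith
      moreover have "- K (- A) n \<in> sets borel" using K(3)[of "- A" n] by auto
      ultimately have "emeasure M (- K (- A) n) \<le> emeasure M A + ennreal e"
        using A \<open>e > 0\<close>
        by (simp add: M measure_pmf.emeasure_eq_measure flip: ennreal_plus)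
      moreover have "open (- K (- A) n)" "A \<subseteq> - K (- A) n" using K[of "- A" n] by auto
      ultimately show "(INF U \<in> {U. open U \<and> A \<subseteq> U}. emeasure M U) \<le> emeasure M A + ennreal e"
        by (intro INF_lower2[of "- K (- A) n"]) auto
    qed
  qed
  have "prob_space M" unfolding M_def by (intro measure_pmf.prob_space_distr) simp
  moreover have sets_M: "sets M = sets borel" by (simp add: M_def)
  ultimately show ?thesis
    unfolding M_def[symmetric] regular_prob_measures_def using inner outer sets_M by blast
qed

lemma measure_support_distr_pmf:
  assumes "k \<in> set_pmf p"
  shows "h k \<in> measure_support (distr (measure_pmf p) borel h)"
proof -
  have "0 < emeasure (distr (measure_pmf p) borel h) U" if "open U" "h k \<in> U" for U
  proof -
    have "0 < emeasure p {k}" using assms by (simp add: emeasure_pmf_single pmf_positive)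
    also have "\<dots> \<le> emeasure p (h -` U)" using that by (intro emeasure_mono) auto
    finally show ?thesis using that by (simp add: emeasure_distr)
  qed
  then show ?thesis by (simp add: measure_support_def)
qed

section \<open>The centralizer and the factorization of the walk\<close>

text \<open>If \<open>x\<close> commuted with \<open>g\<close>, its orbit would be
  \<open>{x}\<close>, whose closure misses \<open>0\<close>. Hence \<open>- x\<close> lies outside
  the closed centralizer, and so does \<open>- v + (- x + v')\<close> for small \<open>v\<close> and
  \<open>v'\<close>; but \<open>x + v + h = v'\<close> would make this point equal to
  \<open>h\<close>.\<close>

lemma ex_nhd_separating_centralizer:
  fixes g x :: "'a::{topological_group_add, t2_space}"
  assumes "x \<noteq> 0" and x: "0 \<in> closure (range (\<lambda>n. ((\<lambda>x. g + x - g) ^^ n) x))"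
  obtains W where "open W" "0 \<in> W"
    "\<And>v v' h. v \<in> W \<Longrightarrow> v' \<in> W \<Longrightarrow> g + h = h + g \<Longrightarrow> x + v + h \<noteq> v'"
proof -
  have "g + x - g \<noteq> x"
  proof
    assume fixed: "g + x - g = x"
    have "((\<lambda>x. g + x - g) ^^ n) x = x" for n by (induction n) (simp_all add: fixed)
    with x \<open>x \<noteq> 0\<close> show False by simp
  qed
  define C where "C = {h. g + h = h + g}"
  have "closed C"
    unfolding C_def by (intro closed_Collect_eq continuous_intros)
  moreover have "- x \<notin> C"
  proof
    assume "- x \<in> C"
    then have "x + (g + - x) + x = x + (- x + g) + x" by (simp add: C_def)
    then have "g + x - g = x" by (simp add: add.assoc diff_eq_eq)
    with \<open>g + x - g \<noteq> x\<close> show False by simp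
  qed
  moreover define d where "d = (\<lambda>p :: 'a \<times> 'a. - fst p + (- x + snd p))"
  moreover have "continuous_on UNIV d"
    unfolding d_def by (intro continuous_intros)
  ultimately have "open (d -` (- C))" "(0, 0) \<in> d -` (- C)"
    by (auto intro!: open_vimage)
  then obtain A B where AB: "open A" "open B" "0 \<in> A" "0 \<in> B" "A \<times> B \<subseteq> d -` (- C)"
    by (auto elim!: open_prod_elim)
  show ?thesis
  proof (rule that[of "A \<inter> B"])
    fix v v' h assume *: "v \<in> A \<inter> B" "v' \<in> A \<inter> B" "g + h = h + g"
    show "x + v + h \<noteq> v'"
    proof
      assume "x + v + h = v'"
      then have "d (v, v') = h" by (auto simp: d_def add.assoc)
      moreover have "d (v, v') \<notin> C" using * AB(5) by auto
      ultimately show False using *(3) by (simp add: C_def)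
    qed
  qed (use AB in auto)
qed

text \<open>Each \<open>x\<close> along the walk is conjugated by the multiple of \<open>g\<close>
  accumulated before it; \<open>u\<close> is the sum of these conjugates, and subadditivity bounds
  \<open>l u\<close>. The induction needs arbitrary \<open>q\<close> because the first step raises
  \<open>q\<close> by \<open>a k\<close>.\<close>

lemma walk_factorization:
  fixes g x :: "'a::group_add" and l :: "'a \<Rightarrow> real"
  assumes "l 0 = 0" and l_add: "\<And>u v. l (u + v) \<le> l u + l v"
  shows "\<exists>u. nmult q g + sum_list (map (\<lambda>k. x + nmult (a k) g) xs) = u + nmult (q + sum_list (map a xs)) g
      \<and> l u \<le> (\<Sum>i<length xs. l (((\<lambda>x. g + x - g) ^^ (q + sum_list (map a (take i xs)))) x))"
proof (induction xs arbitrary: q)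
  case Nil
  then show ?case using assms by (intro exI[of _ 0]) simp
next
  case (Cons k xs)
  let ?\<gamma> = "\<lambda>n. (\<lambda>x. g + x - g) ^^ n"
  obtain u where u: "nmult (q + a k) g + sum_list (map (\<lambda>k. x + nmult (a k) g) xs)
        = u + nmult (q + a k + sum_list (map a xs)) g"
      "l u \<le> (\<Sum>i<length xs. l (?\<gamma> (q + a k + sum_list (map a (take i xs))) x))"
    using Cons[of "q + a k"] by auto
  have "nmult q g + sum_list (map (\<lambda>k. x + nmult (a k) g) (k # xs))
      = (?\<gamma> q x + nmult q g) + nmult (a k) g + sum_list (map (\<lambda>k. x + nmult (a k) g) xs)"
    unfolding conj_funpow_nmult by (simp add: add.assoc)
  also have "\<dots> = ?\<gamma> q x + (nmult (q + a k) g + sum_list (map (\<lambda>k. x + nmult (a k) g) xs))"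
    by (simp add: nmult_add add.assoc)
  also have "\<dots> = (?\<gamma> q x + u) + nmult (q + sum_list (map a (k # xs))) g"
    unfolding u(1) by (simp add: add.assoc)
  finally have "nmult q g + sum_list (map (\<lambda>k. x + nmult (a k) g) (k # xs)) = \<dots>" .
  moreover have "l (?\<gamma> q x + u) \<le> (\<Sum>i<length (k # xs). l (?\<gamma> (q + sum_list (map a (take i (k # xs)))) x))"
    using l_add[of "?\<gamma> q x" u] u(2)
    by (simp add: sum.lessThan_Suc_shift add.assoc del: sum.lessThan_Suc)
  ultimately show ?case by blast
qed

section \<open>The contradiction with the Choquet-Deny property\<close>

theorem corollary6p5:
  assumes "locally_compact_space (euclidean :: 'a::{topological_group_add, t2_space} topology)"
    and "\<forall>\<mu> \<in> (regular_prob_measures :: 'a measure set). choquet_deny \<mu>"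
  shows "pointwise_distal TYPE('a)"
  unfolding pointwise_distal_def
proof (rule allI, rule ccontr)
  fix g :: 'a
  let ?\<gamma> = "\<lambda>n. (\<lambda>x. g + x - g) ^^ n"
  assume "\<not> distal_action {?\<gamma> n | n :: nat. True}"
  then obtain x where "x \<noteq> 0" and x: "0 \<in> closure (range (\<lambda>n. ?\<gamma> n x))"
    by (rule not_distal_imp_conj_accumulates_at_zero)
  obtain W where W: "open W" "0 \<in> W"
    and sep: "\<And>v v' h. v \<in> W \<Longrightarrow> v' \<in> W \<Longrightarrow> g + h = h + g \<Longrightarrow> x + v + h \<noteq> v'"
    by (rule ex_nhd_separating_centralizer[OF \<open>x \<noteq> 0\<close> x], rule that)
  obtain \<phi> :: "'a \<Rightarrow> real" and K where \<phi>: "continuous_on UNIV \<phi>"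
      and \<phi>01: "\<And>z. 0 \<le> \<phi> z" "\<And>z. \<phi> z \<le> 1" and "\<phi> 0 = 1"
      and K: "compact K" "\<And>z. z \<notin> K \<Longrightarrow> \<phi> z = 0" and \<phi>W: "\<And>z. z \<notin> W \<Longrightarrow> \<phi> z = 0"
    using locally_compact_bump_function[OF assms(1) W] by metis
  \<comment> \<open>Left translations are needed for the continuity of the harmonic limit, right
    translations for the smallness of \<open>l\<close> near \<open>0\<close>.\<close>
  have left: "\<exists>U. open U \<and> 0 \<in> U \<and> (\<forall>u\<in>U. \<forall>z. \<bar>\<phi> (u + z) - \<phi> z\<bar> < e)" if "e > 0" for e
    by (rule compact_support_uniform_continuity[OF \<phi> K _ _ _ that, of "\<lambda>u z. u + z"])
       (auto simp: case_prod_beta intro!: continuous_intros simp flip: add.assoc)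
  have right: "\<exists>U. open U \<and> 0 \<in> U \<and> (\<forall>u\<in>U. \<forall>z. \<bar>\<phi> (z + u) - \<phi> z\<bar> < e)" if "e > 0" for e
    by (rule compact_support_uniform_continuity[OF \<phi> K _ _ _ that, of "\<lambda>u z. z + u"])
       (auto simp: case_prod_beta add.assoc intro!: continuous_intros)

  define l where "l = translation_distance \<phi>"
  note l_bounds = translation_distance_bounds[of \<phi>, OF \<phi>01, folded l_def]
  have l_0: "l 0 = 0" and l_add: "l (u + v) \<le> l u + l v" for u v
    unfolding l_def by (rule translation_distance_0, rule translation_distance_add[of \<phi>, OF \<phi>01])
  define w where "w s = l (?\<gamma> s x)" for s
  have small: "\<exists>a. \<forall>s\<le>L. w (a + s) < e" if "e > 0" for L e
  proof -
    obtain U where U: "open U" "0 \<in> U" "\<And>u z. u \<in> U \<Longrightarrow> \<bar>\<phi> (z + u) - \<phi> z\<bar> < e / 2"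
      using right[of "e / 2"] \<open>e > 0\<close> by auto
    have l_U: "l u < e" if "u \<in> U" for u
    proof -
      have "l u \<le> e / 2"
        unfolding l_def translation_distance_def using U(3)[OF that] by (intro cSUP_least less_imp_le) auto
      then show ?thesis using \<open>e > 0\<close> by simp
    qed
    \<comment> \<open>All iterates fix \<open>0\<close>, so this is a neighbourhood of
      \<open>0\<close>; once the orbit of \<open>x\<close> enters it, the orbit stays in
      \<open>U\<close> for the next \<open>L\<close> steps.\<close>
    have "open (\<Inter>s\<le>L. ?\<gamma> s -` U)"
      by (intro open_INT finite_atMost ballI open_vimage U continuous_conj_funpow)
    moreover have "0 \<in> (\<Inter>s\<le>L. ?\<gamma> s -` U)" using U(2) by (simp add: conj_funpow_zero)
    ultimately have "(\<Inter>s\<le>L. ?\<gamma> s -` U) \<inter> range (\<lambda>n. ?\<gamma> n x) \<noteq> {}"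
      using x open_Int_closure_eq_empty[of "\<Inter>s\<le>L. ?\<gamma> s -` U" "range (\<lambda>n. ?\<gamma> n x)"] by blast
    then obtain a where "?\<gamma> a x \<in> (\<Inter>s\<le>L. ?\<gamma> s -` U)" by auto
    then have "w (a + s) < e" if "s \<le> L" for s
      using that by (auto simp: w_def add.commute[of a] funpow_add intro!: l_U)
    then show ?thesis by blast
  qed
  have w01: "0 \<le> w s" "w s \<le> 1" for s using l_bounds by (auto simp: w_def)
  \<comment> \<open>Any constant below \<open>1 / 2\<close> would do: it bounds
    \<open>f (x + y)\<close> and \<open>1 - f y\<close>, which must not allow equal values.\<close>
  obtain p :: "nat pmf" and a :: "nat \<Rightarrow> nat" and j where p: "set_pmf p = UNIV" and a: "a 0 = 0"
    and cost: "\<And>M. (\<Sum>n<M. measure_pmf.expectation (replicate_pmf n p)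
                 (\<lambda>xs. w (a j + sum_list (map a xs)))) < 1 / 4"
    using ex_transient_random_walk[of w "1 / 4", OF w01 small] by auto

  define h where "h k = x + nmult (a k) g" for k
  \<comment> \<open>The supremum makes \<open>F\<close> invariant under adding multiples of
    \<open>g\<close> on the right. The whole centralizer is taken because it is closed, which is
    what \<open>sep\<close> rests on.\<close>
  define F where "F z = (SUP c \<in> {c. g + c = c + g}. \<phi> (z + c))" for z

  have bdd: "bdd_above ((\<lambda>c. \<phi> (z + c)) ` {c. g + c = c + g})" for z
    using \<phi>01 by (intro bdd_aboveI2[of _ _ 1])
  have F_upper: "\<phi> (z + c) \<le> F z" if "g + c = c + g" for z c
    unfolding F_def using that by (intro cSUP_upper bdd) simp
  have F_least: "F z \<le> b" if "\<And>c. g + c = c + g \<Longrightarrow> \<phi> (z + c) \<le> b" for z b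
    unfolding F_def using that by (intro cSUP_least) (auto intro: exI[of _ 0])
  have F01: "0 \<le> F z" "F z \<le> 1" for z
    using F_upper[of 0 z] \<phi>01(1)[of z] by (simp, intro F_least \<phi>01)
  have F_le_add: "F (z + c) \<le> F z" if "g + c = c + g" for z c
  proof (rule F_least)
    fix d assume "g + d = d + g"
    then have "g + (c + d) = (c + d) + g" using that by (metis add.assoc)
    then show "\<phi> (z + c + d) \<le> F z" using F_upper[of "c + d" z] by (simp add: add.assoc)
  qed
  have F_nmult: "F (z + nmult n g) = F z" for z n
  proof (rule antisym)
    have comm: "g + nmult n g = nmult n g + g" using nmult_add[of 1 n g] nmult_add[of n 1 g] by simp
    then show "F (z + nmult n g) \<le> F z" by (rule F_le_add)
    have "- nmult n g + (g + nmult n g) + - nmult n g = - nmult n g + (nmult n g + g) + - nmult n g"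
      by (simp only: comm)
    then have "g + - nmult n g = - nmult n g + g"
      by (simp add: add.assoc del: add_uminus_conv_diff)
    from F_le_add[OF this, of "z + nmult n g"] show "F z \<le> F (z + nmult n g)"
      by (simp add: add.assoc)
  qed
  have F_unif: "\<exists>U. open U \<and> 0 \<in> U \<and> (\<forall>u\<in>U. \<forall>z. \<bar>F (u + z) - F z\<bar> < e)" if "e > 0" for e
  proof -
    obtain U where U: "open U" "0 \<in> U" "\<And>u z. u \<in> U \<Longrightarrow> \<bar>\<phi> (u + z) - \<phi> z\<bar> < e / 2"
      using left[of "e / 2"] \<open>e > 0\<close> by auto
    have "\<bar>F (u + z) - F z\<bar> < e" if "u \<in> U" for u z
    proof -
      have "F (u + z) \<le> F z + e / 2"
      proof (rule F_least)
        fix c assume "g + c = c + g"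
        then show "\<phi> (u + z + c) \<le> F z + e / 2"
          using F_upper[of c z] U(3)[OF that, of "z + c"] unfolding add.assoc by linarith
      qed
      moreover have "F z \<le> F (u + z) + e / 2"
      proof (rule F_least)
        fix c assume "g + c = c + g"
        then show "\<phi> (z + c) \<le> F (u + z) + e / 2"
          using F_upper[of c "u + z"] U(3)[OF that, of "z + c"] unfolding add.assoc by linarith
      qed
      ultimately show ?thesis using \<open>e > 0\<close> by linarith
    qed
    with U show ?thesis by blast
  qed
  have F_near: "1 - l u \<le> F u" for u
    using l_bounds(1)[of 0 u] \<open>\<phi> 0 = 1\<close> F_upper[of 0 u] by simp
  \<comment> \<open>If \<open>l u < 1\<close>, then \<phi> cannot have dropped from \<open>1\<close>
    at \<open>0\<close> to \<open>0\<close> at \<open>u\<close>, so \<open>u\<close> lies in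
    \<open>W\<close>, and by \<open>sep\<close> no \<open>x + u + c\<close> does.\<close>
  have F_far: "F (x + u) \<le> l u" for u
  proof (cases "l u < 1")
    case True
    then have "\<phi> u \<noteq> 0" using l_bounds(1)[of 0 u] \<open>\<phi> 0 = 1\<close> by auto
    then have "u \<in> W" using \<phi>W by blast
    then have "\<phi> (x + u + c) = 0" if "g + c = c + g" for c
      using sep[of u _ c] that \<phi>W by blast
    then show ?thesis using l_bounds(2)[of u] by (intro F_least) simp
  next
    case False
    then show ?thesis using F01(2)[of "x + u"] by simp
  qed

  obtain f where f: "continuous_on UNIV f" "\<And>y. 0 \<le> f y" "\<And>y. f y \<le> 1"
      "\<And>y. f y = measure_pmf.expectation p (\<lambda>k. f (y + h k))"
    and f_ge: "\<And>y c. \<forall>n. c \<le> walk_expectation p h F n y \<Longrightarrow> c \<le> f y"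
    and f_le: "\<And>y c. \<forall>n. walk_expectation p h F n y \<le> c \<Longrightarrow> f y \<le> c"
    by (rule ex_harmonic_limit[of F p h, OF F01 F_unif], assumption, rule that)

  define \<mu> where "\<mu> = distr (measure_pmf p) borel h"
  define y where "y = nmult (a j) g"

  have "f (x + y) = f y"
  proof -
    have "choquet_deny \<mu>" using assms(2) distr_pmf_nat_regular by (auto simp: \<mu>_def)
    moreover have "continuous_on UNIV (\<lambda>z. complex_of_real (f z))"
      by (intro continuous_intros f)
    moreover have "bounded (range (\<lambda>z. complex_of_real (f z)))"
      using f(2,3) by (intro boundedI[of _ 1]) auto
    moreover have "complex_of_real (f z) = (LINT u|\<mu>. complex_of_real (f (z + u)))" for z
    proof -
      have "(\<lambda>u. f (z + u)) \<in> borel_measurable borel"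
        by (intro borel_measurable_continuous_onI continuous_on_compose2[OF f(1)] continuous_intros) auto
      then have "(LINT u|\<mu>. f (z + u)) = f z"
        unfolding \<mu>_def by (subst integral_distr) (auto simp: f(4)[symmetric])
      then show ?thesis by simp
    qed
    ultimately have const: "(\<lambda>z. complex_of_real (f z)) constant_on (+) 0 ` support_subgroup \<mu>"
      unfolding choquet_deny_def by blast
    have "h k \<in> H" if "closed_subgroup H" "measure_support \<mu> \<subseteq> H" for H k
      using that measure_support_distr_pmf[of k p h] p by (auto simp: \<mu>_def)
    \<comment> \<open>Here \<open>h 0 = x\<close>, as \<open>a 0 = 0\<close>, and
      \<open>h j = x + y\<close>. Thus \<open>x + y\<close> and \<open>y = - x + (x + y)\<close> lie
      in the same coset, that of \<open>0\<close>.\<close>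
    from this[of _ 0] this[of _ j] have H: "x \<in> H" "x + y \<in> H"
        if "closed_subgroup H" "measure_support \<mu> \<subseteq> H" for H
      using that by (auto simp: h_def a y_def)
    have "y \<in> H" if "closed_subgroup H" "measure_support \<mu> \<subseteq> H" for H
    proof -
      have "- x + (x + y) \<in> H" using H[OF that] that(1) unfolding closed_subgroup_def by blast
      then show ?thesis by (simp flip: add.assoc)
    qed
    with H have "y \<in> support_subgroup \<mu>" "x + y \<in> support_subgroup \<mu>"
      by (auto simp: support_subgroup_def)
    moreover obtain b where "\<And>z. z \<in> support_subgroup \<mu> \<Longrightarrow> complex_of_real (f z) = b"
      using const by (auto simp: constant_on_def)
    ultimately show ?thesis by (metis of_real_eq_iff)
  qed
  moreover
  define c where "c xs = (\<Sum>i<length xs. w (a j + sum_list (map a (take i xs))))" for xs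
  \<comment> \<open>By the factorization the walks from \<open>y\<close> and from
    \<open>x + y\<close> end at \<open>u\<close> and \<open>x + u\<close> up to the same multiple of
    \<open>g\<close>, which \<open>F\<close> ignores.\<close>
  have walk: "1 - c xs \<le> F (y + sum_list (map h xs))" "F (x + y + sum_list (map h xs)) \<le> c xs" for xs
  proof -
    obtain u where u: "y + sum_list (map h xs) = u + nmult (a j + sum_list (map a xs)) g" "l u \<le> c xs"
      unfolding y_def h_def c_def w_def
      using walk_factorization[of l "a j" g x a xs, OF l_0 l_add] by (elim exE conjE)
    have "F (y + sum_list (map h xs)) = F u" by (simp add: u F_nmult)
    then show "1 - c xs \<le> F (y + sum_list (map h xs))" using F_near[of u] u(2) by simp
    have "F (x + y + sum_list (map h xs)) = F (x + u + nmult (a j + sum_list (map a xs)) g)"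
      using u(1) by (simp add: add.assoc)
    then show "F (x + y + sum_list (map h xs)) \<le> c xs" using F_far[of u] u(2) by (simp add: F_nmult)
  qed
  \<comment> \<open>On lists of length \<open>n\<close> the cost is a sum of \<open>n\<close> terms,
    each depending on a prefix that is itself a sample of length \<open>i\<close>; its expectation
    is therefore the sum bounded in \<open>cost\<close>.\<close>
  have c_exp: "integrable (replicate_pmf n p) c" "measure_pmf.expectation (replicate_pmf n p) c < 1 / 4" for n
  proof -
    let ?w = "\<lambda>xs. w (a j + sum_list (map a xs))"
    have int: "integrable (replicate_pmf n p) (\<lambda>xs. \<Sum>i<n. ?w (take i xs))"
      by (intro Bochner_Integration.integrable_sum integrable_pmf_bounded w01)
    have ae: "AE xs in replicate_pmf n p. c xs = (\<Sum>i<n. ?w (take i xs))"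
      by (auto simp: AE_measure_pmf_iff set_replicate_pmf c_def)
    show "integrable (replicate_pmf n p) c"
      using int ae by (subst integrable_cong_AE) auto
    have "measure_pmf.expectation (replicate_pmf n p) c
        = measure_pmf.expectation (replicate_pmf n p) (\<lambda>xs. \<Sum>i<n. ?w (take i xs))"
      using ae by (intro integral_cong_AE) auto
    also have "\<dots> = (\<Sum>i<n. measure_pmf.expectation (replicate_pmf n p) (\<lambda>xs. ?w (take i xs)))"
      by (intro Bochner_Integration.integral_sum integrable_pmf_bounded w01)
    also have "\<dots> = (\<Sum>i<n. measure_pmf.expectation (replicate_pmf i p) ?w)"
      by (intro sum.cong refl expectation_replicate_pmf_take w01) simp
    finally show "measure_pmf.expectation (replicate_pmf n p) c < 1 / 4" using cost[of n] by simp
  qed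
  have int_F: "integrable (replicate_pmf n p) (\<lambda>xs. F (z + sum_list (map h xs)))" for n z
    by (intro integrable_pmf_bounded F01)
  have "3 / 4 \<le> f y"
  proof (intro f_ge allI)
    fix n
    have "measure_pmf.expectation (replicate_pmf n p) (\<lambda>xs. 1 - c xs) \<le> walk_expectation p h F n y"
      unfolding walk_expectation_def using walk c_exp int_F by (intro integral_mono) auto
    then show "3 / 4 \<le> walk_expectation p h F n y"
      using c_exp[of n] by (simp add: Bochner_Integration.integral_diff)
  qed
  moreover have "f (x + y) \<le> 1 / 4"
  proof (intro f_le allI)
    fix n
    have "walk_expectation p h F n (x + y) \<le> measure_pmf.expectation (replicate_pmf n p) c"
      unfolding walk_expectation_def using walk c_exp int_F by (intro integral_mono) auto
    then show "walk_expectation p h F n (x + y) \<le> 1 / 4" using c_exp(2)[of n] by simp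
  qed
  ultimately show False by simp
qed

end
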